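(* For every integer $n\ge 1$ and every matrix $G\in\mathbb{C}^{n\times n}$, $$ \min_{W\in\mathbb{C}^{n\times n}\ \text{nonsingular}} \|W\circ G\|_{\mathrm F}\,\|W^{-1}\circ G^{\mathrm T}\|_{\mathrm F} =\min_{P}\|P\circ G\|_{\mathrm F}^2, $$ where on the right $P$ ranges over all $n\times n$ permutation matrices (in particular, the minimum on the left is attained).
   Context: For matrices $X=[x_{ij}]$, $Y=[y_{ij}]$ of the same size, $X\circ Y=[x_{ij}y_{ij}]$ is the Hadamard (entrywise) product. $\|\cdot\|_{\mathrm F}$ is the Frobenius norm, and $G^{\mathrm T}$ is the transpose of $G$ (without complex conjugation). *)

theory Defs
  imports "HOL-Analysis.Analysis"
begin

definition hadamard :: "'a::times^'m^'n \<Rightarrow> 'a^'m^'n \<Rightarrow> 'a^'m^'n"  (infixl "\<circ>\<^sub>H" 70)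
  where "X \<circ>\<^sub>H Y = (\<chi> i j. X $ i $ j * Y $ i $ j)"

definition frobenius_norm :: "complex^'m^'n \<Rightarrow> real"
  where "frobenius_norm X = sqrt (\<Sum>i\<in>UNIV. \<Sum>j\<in>UNIV. (cmod (X $ i $ j))\<^sup>2)"

lemma frobenius_norm_eq_norm: "frobenius_norm X = norm X"
  by (simp add: frobenius_norm_def norm_vec_def L2_set_def sum_nonneg)

definition permutation_matrix :: "'a::zero_neq_one^'n^'n \<Rightarrow> bool"
  where "permutation_matrix P \<longleftrightarrow>
    (\<exists>\<sigma>. \<sigma> permutes UNIV \<and> P = (\<chi> i j. if j = \<sigma> i then 1 else 0))"

text \<open>The following two facts ensure that \<open>Min\<close> over the permutation matrices is a true minimum.\<close>

lemma finite_permutation_matrices: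
  "finite {P :: 'a::zero_neq_one^'n^'n. permutation_matrix P}"
proof -
  have "{P :: 'a^'n^'n. permutation_matrix P} =
      (\<lambda>\<sigma>. \<chi> i j. if j = \<sigma> i then 1 else 0) ` {\<sigma>. \<sigma> permutes UNIV}"
    by (auto simp: permutation_matrix_def)
  then show ?thesis
    by (simp add: finite_permutations)
qed

lemma permutation_matrix_mat_1: "permutation_matrix (mat 1 :: 'a::semiring_1^'n^'n)"
  unfolding permutation_matrix_def mat_def
  by (intro exI[of _ id]) (auto simp: permutes_id vec_eq_iff)

text \<open>Unlike \<open>Min\<close>, this is meaningful for infinite sets: it asserts that the minimum exists
  (is attained) and equals \<open>m\<close>.\<close>

definition is_minimum :: "'a::order set \<Rightarrow> 'a \<Rightarrow> bool"
  where "is_minimum S m \<longleftrightarrow> m \<in> S \<and> (\<forall>x\<in>S. m \<le> x)"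

end

theory Submission
  imports Defs "HOL-Combinatorics.Cycles"
begin

text \<open>
  A permutation matrix \<open>P\<close> has inverse \<open>P\<^sup>T\<close>, so \<open>W = P\<close> turns the product on the left into
  \<open>\<parallel>P \<circ> G\<parallel>\<^sup>2\<close>; the work lies in the lower bound. Put \<open>V = W\<^sup>-\<^sup>1\<close>, \<open>c\<^sub>i\<^sub>j = \<bar>G\<^sub>i\<^sub>j\<bar>\<^sup>2\<close> and
  \<open>h\<^sub>i\<^sub>j = (\<bar>W\<^sub>i\<^sub>j\<bar>\<^sup>2 + \<bar>V\<^sub>j\<^sub>i\<bar>\<^sup>2) / 2\<close>. Both sides of the inequality are insensitive to
  replacing \<open>W\<close> by \<open>t W\<close> with \<open>t > 0\<close>, and with a balancing choice of \<open>t\<close> the product of the two norms is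
  half the sum of their squares (\<open>le_mult_of_scaled_squares\<close>). Hence it suffices to show that
  \<open>\<Sum>\<^sub>i\<^sub>j h\<^sub>i\<^sub>j c\<^sub>i\<^sub>j\<close> is at least the optimal value of the assignment problem with costs \<open>c\<close>.

  Two facts give this. First, every rectangle \<open>I \<times> J\<close> of entries of \<open>h\<close> has sum at least
  \<open>\<bar>I\<bar> + \<bar>J\<bar> - n\<close> (\<open>rectangle_sum_inverse_pair\<close>): the vectors supported on \<open>I\<close> and the images under
  \<open>W\<close> of the vectors supported on \<open>J\<close> meet in dimension at least \<open>\<bar>I\<bar> + \<bar>J\<bar> - n\<close>, and on that
  intersection the product of the blocks \<open>W[I,J]\<close> and \<open>V[J,I]\<close> acts as the identity. The trace of
  this identity, computed in an orthonormal basis, is bounded by the squared Frobenius norms of the blocks.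

  Second, the rectangle bounds alone imply the assignment bound
  (\<open>assignment_le_of_rectangle_sums\<close>). By linear programming duality (\<open>assignment_duality\<close>) there are
  \<open>u\<close> and \<open>v\<close> with \<open>u\<^sub>i + v\<^sub>j \<le> c\<^sub>i\<^sub>j\<close> whose total is the optimal value. Since \<open>c \<ge> 0\<close>, the matrix \<open>c\<close>
  dominates the positive part of \<open>u\<^sub>i + v\<^sub>j\<close>, which is the integral over \<open>s\<close> of the indicator of
  \<open>- v\<^sub>j \<le> s < u\<^sub>i\<close>. For fixed \<open>s\<close> this indicator is that of a rectangle, so the rectangle bound applies
  to each layer, and integrating the bounds gives \<open>\<Sum>\<^sub>i u\<^sub>i + \<Sum>\<^sub>j v\<^sub>j\<close>.
\<close>

section \<open>Potentials of weighted digraphs without negative cycles\<close>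

definition path_weight :: "('a \<Rightarrow> 'a \<Rightarrow> real) \<Rightarrow> 'a list \<Rightarrow> real"
  where "path_weight w xs = (\<Sum>(x, y)\<leftarrow>zip xs (tl xs). w x y)"

definition cycle_weight :: "('a \<Rightarrow> 'a \<Rightarrow> real) \<Rightarrow> 'a list \<Rightarrow> real"
  where "cycle_weight w xs = (\<Sum>(x, y)\<leftarrow>zip xs (rotate1 xs). w x y)"

lemma path_weight_Cons: "path_weight w (x # y # ys) = w x y + path_weight w (y # ys)"
  by (simp add: path_weight_def)

lemma path_weight_split_cycle:
  "path_weight w (x # xs @ x # ys) = cycle_weight w (x # xs) + path_weight w (x # ys)"
proof -
  have "zip (x # xs @ x # ys) (xs @ x # ys) = zip ((x # xs) @ (x # ys)) ((xs @ [x]) @ ys)"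
    by simp
  also have "\<dots> = zip (x # xs) (xs @ [x]) @ zip (x # ys) ys"
    by (subst zip_append) simp_all
  finally show ?thesis
    by (simp add: path_weight_def cycle_weight_def)
qed

text \<open>
  The potential of \<open>i\<close> is the least weight of a path that starts at \<open>i\<close> and repeats no vertex. Prefixing the
  edge from \<open>i\<close> to \<open>j\<close> to a best path from \<open>j\<close> gives the inequality, unless \<open>i\<close> already occurs on that
  path; then the part up to this occurrence closes a cycle, and cutting it off does not increase the weight.
\<close>
lemma potential_exists:
  fixes w :: "'a::finite \<Rightarrow> 'a \<Rightarrow> real"
  assumes cyc: "\<And>xs. distinct xs \<Longrightarrow> xs \<noteq> [] \<Longrightarrow> 0 \<le> cycle_weight w xs"
  shows "\<exists>p. \<forall>i j. p i \<le> w i j + p j"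
proof -
  define P where "P i = {i # xs | xs. distinct (i # xs)}" for i :: 'a
  define p where "p i = Min (path_weight w ` P i)" for i
  have fin: "finite (P i)" for i
  proof (rule finite_subset)
    show "P i \<subseteq> {xs. set xs \<subseteq> UNIV \<and> length xs \<le> CARD('a)}"
    proof
      fix xs assume "xs \<in> P i"
      then have "length xs = card (set xs)"
        unfolding P_def using distinct_card by fastforce
      then show "xs \<in> {xs. set xs \<subseteq> UNIV \<and> length xs \<le> CARD('a)}"
        by (simp add: card_mono)
    qed
    show "finite {xs. set xs \<subseteq> (UNIV :: 'a set) \<and> length xs \<le> CARD('a)}"
      by (rule finite_lists_length_le) simp
  qed
  have p_le: "p i \<le> path_weight w (i # xs)" if "distinct (i # xs)" for i xs
    unfolding p_def using that by (intro Min_le finite_imageI fin imageI) (auto simp: P_def)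
  have p_att: "\<exists>xs. distinct (i # xs) \<and> p i = path_weight w (i # xs)" for i
  proof -
    have "[i] \<in> P i"
      by (simp add: P_def)
    then have "p i \<in> path_weight w ` P i"
      unfolding p_def by (intro Min_in finite_imageI fin) auto
    then show ?thesis
      by (auto simp: P_def)
  qed
  have "p i \<le> w i j + p j" for i j
  proof -
    obtain xs where xs: "distinct (j # xs)" "p j = path_weight w (j # xs)"
      using p_att by blast
    show ?thesis
    proof (cases "i \<in> set (j # xs)")
      case False
      then have "p i \<le> path_weight w (i # j # xs)"
        using xs by (intro p_le) auto
      then show ?thesis
        using xs by (simp add: path_weight_Cons)
    next
      case True
      then obtain q r where qr: "j # xs = q @ i # r"
        by (meson split_list)
      then have d: "distinct (i # q)" "distinct (i # r)"
        using xs(1) by auto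
      have "w i j + p j = path_weight w (i # q @ i # r)"
        using xs qr path_weight_Cons[of w i j xs] by simp
      also have "\<dots> = cycle_weight w (i # q) + path_weight w (i # r)"
        by (rule path_weight_split_cycle)
      finally show ?thesis
        using cyc[OF d(1)] p_le[OF d(2)] by simp
    qed
  qed
  then show ?thesis
    by blast
qed

section \<open>Duality for the assignment problem\<close>

text \<open>
  Weight the edge from \<open>i\<close> to \<open>j\<close> by \<open>c i j - c j j\<close>. A cycle of this digraph, read as a permutation,
  has as its weight the increase in cost when the identity is replaced by it; so optimality of the identity
  excludes negative cycles, and a potential \<open>p\<close> yields the dual solution \<open>u i = p i\<close>,
  \<open>v j = c j j - p j\<close>.
\<close>
lemma assignment_duality_id:
  fixes c :: "'n::finite \<Rightarrow> 'n \<Rightarrow> real"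
  assumes opt: "\<And>\<tau>. \<tau> permutes UNIV \<Longrightarrow> (\<Sum>i\<in>UNIV. c i i) \<le> (\<Sum>i\<in>UNIV. c i (\<tau> i))"
  shows "\<exists>u v. (\<forall>i j. u i + v j \<le> c i j) \<and> sum u UNIV + sum v UNIV = (\<Sum>i\<in>UNIV. c i i)"
proof -
  define w where "w i j = c i j - c j j" for i j
  have "0 \<le> cycle_weight w xs" if "distinct xs" for xs
  proof -
    define \<tau> where "\<tau> = cycle_of_list xs"
    have tau: "\<tau> permutes UNIV"
      unfolding \<tau>_def by (rule permutes_subset[OF cycle_permutes]) simp
    have fixed: "\<tau> i = i" if "i \<notin> set xs" for i
      using that by (simp add: \<tau>_def id_outside_supp)
    have "rotate1 xs = map \<tau> xs"
      using cyclic_rotation[OF that, of 1] by (simp add: \<tau>_def)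
    then have "cycle_weight w xs = (\<Sum>x\<leftarrow>xs. w x (\<tau> x))"
      unfolding cycle_weight_def
      by (simp add: zip_map2 zip_same_conv_map o_def)
    also have "\<dots> = (\<Sum>x\<in>set xs. w x (\<tau> x))"
      using that by (simp add: sum_list_distinct_conv_sum_set)
    also have "\<dots> = (\<Sum>x\<in>UNIV. w x (\<tau> x))"
      by (rule sum.mono_neutral_left) (auto simp: fixed w_def)
    also have "\<dots> = (\<Sum>i\<in>UNIV. c i (\<tau> i)) - (\<Sum>i\<in>UNIV. c (\<tau> i) (\<tau> i))"
      by (simp add: w_def sum_subtractf)
    also have "(\<Sum>i\<in>UNIV. c (\<tau> i) (\<tau> i)) = (\<Sum>i\<in>UNIV. c i i)"
      using sum.permute[OF tau, of "\<lambda>i. c i i"] by (simp add: o_def)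
    finally show ?thesis
      using opt[OF tau] by simp
  qed
  then obtain p where p: "\<And>i j. p i \<le> w i j + p j"
    using potential_exists[of w] by blast
  have "\<forall>i j. p i + (c j j - p j) \<le> c i j"
    using p by (simp add: w_def algebra_simps)
  moreover have "sum p UNIV + (\<Sum>j\<in>UNIV. c j j - p j) = (\<Sum>i\<in>UNIV. c i i)"
    by (simp add: sum_subtractf)
  ultimately show ?thesis
    by (intro exI[of _ p] exI[of _ "\<lambda>j. c j j - p j"] conjI)
qed

text \<open>
  This is Egervary's theorem. Relabelling the columns by an optimal permutation makes the identity optimal.
\<close>
theorem assignment_duality:
  fixes c :: "'n::finite \<Rightarrow> 'n \<Rightarrow> real"
  obtains \<sigma> u v where "\<sigma> permutes UNIV" "\<And>i j. u i + v j \<le> c i j"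
    "sum u UNIV + sum v UNIV = (\<Sum>i\<in>UNIV. c i (\<sigma> i))"
proof -
  have fin: "finite {\<sigma>. \<sigma> permutes (UNIV :: 'n set)}"
    by (simp add: finite_permutations)
  have ne: "{\<sigma>. \<sigma> permutes (UNIV :: 'n set)} \<noteq> {}"
    using permutes_id by blast
  obtain \<sigma> where sigma: "\<sigma> permutes (UNIV :: 'n set)"
    and min: "\<And>\<tau>. \<tau> permutes UNIV \<Longrightarrow> (\<Sum>i\<in>UNIV. c i (\<sigma> i)) \<le> (\<Sum>i\<in>UNIV. c i (\<tau> i))"
    using ex_min_if_finite[OF finite_imageI[OF fin, of "\<lambda>\<sigma>. \<Sum>i\<in>UNIV. c i (\<sigma> i)"]] ne
    by (fastforce simp: not_less)
  obtain u v where uv: "\<And>i j. u i + v j \<le> c i (\<sigma> j)"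
    "sum u UNIV + sum v UNIV = (\<Sum>i\<in>UNIV. c i (\<sigma> i))"
    using assignment_duality_id[of "\<lambda>i j. c i (\<sigma> j)"] min permutes_compose[OF _ sigma]
    by (auto simp: o_def)
  show thesis
  proof
    show "\<sigma> permutes UNIV" by fact
    show "u i + (v \<circ> inv \<sigma>) j \<le> c i j" for i j
      using uv(1)[of i "inv \<sigma> j"] by (simp add: permutes_inverses[OF sigma])
    show "sum u UNIV + sum (v \<circ> inv \<sigma>) UNIV = (\<Sum>i\<in>UNIV. c i (\<sigma> i))"
      using uv(2) sum.permute[OF permutes_inv[OF sigma], of v] by simp
  qed
qed

section \<open>From rectangle bounds to the assignment bound\<close>

lemma has_integral_lower_step:
  fixes a M :: real
  assumes "\<bar>a\<bar> \<le> M"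
  shows "((\<lambda>s. of_bool (s < a)) has_integral a + M) {- M..M}"
proof -
  have "((\<lambda>s. 1::real) has_integral a + M) {- M..a}"
    using has_integral_const_real[of "1::real" "- M" a] assms by (simp add: add.commute abs_le_iff)
  then have "((\<lambda>s. if s \<in> {- M..a} then 1 else 0 :: real) has_integral a + M) {- M..M}"
    using assms by (subst has_integral_restrict) auto
  then show ?thesis
    by (rule has_integral_spike_finite[where S = "{a}", rotated 2]) auto
qed

text \<open>
  Bounds on rectangles pass to general costs by a layer-cake argument: at level \<open>s\<close> the rectangle
  is \<open>{i. s < u i} \<times> {j. - v j \<le> s}\<close> for a dual solution \<open>u\<close>, \<open>v\<close>. The integral is taken over a bounded
  interval \<open>[- M, M]\<close> that contains all jumps, so that the contributions of \<open>M\<close> cancel.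
\<close>
theorem assignment_le_of_rectangle_sums:
  fixes h c :: "'n::finite \<Rightarrow> 'n \<Rightarrow> real"
  assumes h: "\<And>i j. 0 \<le> h i j" and c: "\<And>i j. 0 \<le> c i j"
    and rect: "\<And>I J. real (card I) + real (card J) - real CARD('n) \<le> (\<Sum>i\<in>I. \<Sum>j\<in>J. h i j)"
  obtains \<sigma> where "\<sigma> permutes UNIV" "(\<Sum>i\<in>UNIV. c i (\<sigma> i)) \<le> (\<Sum>i\<in>UNIV. \<Sum>j\<in>UNIV. h i j * c i j)"
proof -
  obtain \<sigma> u v where sigma: "\<sigma> permutes UNIV" and uv: "\<And>i j. u i + v j \<le> c i j"
    and sum: "sum u UNIV + sum v UNIV = (\<Sum>i\<in>UNIV. c i (\<sigma> i))"
    using assignment_duality[of c] by blast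
  define M where "M = (\<Sum>i\<in>UNIV. \<bar>u i\<bar>) + (\<Sum>j\<in>UNIV. \<bar>v j\<bar>)"
  have "\<bar>u i\<bar> \<le> (\<Sum>i\<in>UNIV. \<bar>u i\<bar>)" "\<bar>v i\<bar> \<le> (\<Sum>i\<in>UNIV. \<bar>v i\<bar>)" for i
    by (rule member_le_sum; simp)+
  then have uM: "\<bar>u i\<bar> \<le> M" and vM: "\<bar>- v i\<bar> \<le> M" for i
    unfolding M_def using sum_nonneg[of UNIV "\<lambda>i. \<bar>u i\<bar>"] sum_nonneg[of UNIV "\<lambda>i. \<bar>v i\<bar>"]
    by (smt (verit) abs_ge_zero)+
  have mM: "\<bar>min (u i) (- v j)\<bar> \<le> M" for i j
    using uM[of i] vM[of j] by (simp add: min_def)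
  \<comment> \<open>\<open>f s\<close> is the lower bound \<open>card I + card J - n\<close> for the rectangle at level \<open>s\<close>, and \<open>g s\<close> is
    the sum of \<open>h\<close> over it: a difference of two lower steps is the indicator of \<open>- v j \<le> s < u i\<close>, also
    when that interval is empty.\<close>
  define f where "f s = (\<Sum>i\<in>UNIV. of_bool (s < u i)) - (\<Sum>j\<in>UNIV. of_bool (s < - v j) :: real)" for s :: real
  define g where "g s = (\<Sum>i\<in>UNIV. \<Sum>j\<in>UNIV. h i j * (of_bool (s < u i) - of_bool (s < min (u i) (- v j))))"
    for s :: real
  have "(f has_integral (\<Sum>i\<in>UNIV. u i + M) - (\<Sum>j\<in>UNIV. - v j + M)) {- M..M}"
    unfolding f_def
    by (intro has_integral_diff has_integral_sum has_integral_lower_step uM vM) auto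
  moreover have "(g has_integral (\<Sum>i\<in>UNIV. \<Sum>j\<in>UNIV. h i j * ((u i + M) - (min (u i) (- v j) + M)))) {- M..M}"
    unfolding g_def
    by (intro has_integral_diff has_integral_sum has_integral_mult_right has_integral_lower_step uM mM) auto
  moreover have "f s \<le> g s" for s
  proof -
    define I where "I = {i. s < u i}"
    define J where "J = {j. \<not> s < - v j}"
    have "(\<Sum>j\<in>UNIV. of_bool (s < - v j)) = real (card (- J))"
      by (simp add: J_def Collect_neg_eq)
    also have "\<dots> = real CARD('n) - real (card J)"
      by (simp add: Compl_eq_Diff_UNIV card_Diff_subset of_nat_diff card_mono)
    finally have "f s = real (card I) + real (card J) - real CARD('n)"
      by (simp add: f_def I_def)
    also have "\<dots> \<le> (\<Sum>i\<in>I. \<Sum>j\<in>J. h i j)"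
      by (rule rect)
    also have "\<dots> = (\<Sum>i\<in>UNIV. \<Sum>j\<in>UNIV. if i \<in> I \<and> j \<in> J then h i j else 0)"
    proof -
      have "(\<Sum>i\<in>I. \<Sum>j\<in>J. h i j) = (\<Sum>i\<in>UNIV. if i \<in> I then \<Sum>j\<in>UNIV. if j \<in> J then h i j else 0 else 0)"
        by (simp add: sum.If_cases)
      also have "\<dots> = (\<Sum>i\<in>UNIV. \<Sum>j\<in>UNIV. if i \<in> I \<and> j \<in> J then h i j else 0)"
        by (intro sum.cong) auto
      finally show ?thesis .
    qed
    also have "\<dots> = g s"
      unfolding g_def by (intro sum.cong refl) (auto simp: I_def J_def)
    finally show ?thesis .
  qed
  ultimately have "(\<Sum>i\<in>UNIV. u i + M) - (\<Sum>j\<in>UNIV. - v j + M)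
      \<le> (\<Sum>i\<in>UNIV. \<Sum>j\<in>UNIV. h i j * ((u i + M) - (min (u i) (- v j) + M)))"
    by (rule has_integral_le)
  also have "\<dots> \<le> (\<Sum>i\<in>UNIV. \<Sum>j\<in>UNIV. h i j * c i j)"
  proof (intro sum_mono mult_left_mono h)
    show "(u i + M) - (min (u i) (- v j) + M) \<le> c i j" for i j
      using uv[of i j] c[of i j] by (simp add: min_def)
  qed
  finally have "(\<Sum>i\<in>UNIV. c i (\<sigma> i)) \<le> (\<Sum>i\<in>UNIV. \<Sum>j\<in>UNIV. h i j * c i j)"
    using sum by (simp add: sum.distrib sum_subtractf sum_negf)
  with sigma show thesis
    by (rule that)
qed

section \<open>Rectangle sums of a matrix and its inverse\<close>

lemma bessel_inequality:
  fixes a :: "'a::real_inner"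
  assumes fin: "finite B" and orth: "pairwise orthogonal B" and unit: "\<And>b. b \<in> B \<Longrightarrow> norm b = 1"
  shows "(\<Sum>b\<in>B. (a \<bullet> b)\<^sup>2) \<le> (norm a)\<^sup>2"
proof -
  define p where "p = (\<Sum>b\<in>B. (a \<bullet> b) *\<^sub>R b)"
  have pb: "p \<bullet> b = a \<bullet> b" if "b \<in> B" for b
  proof -
    have "p \<bullet> b = (\<Sum>x\<in>B. if x = b then a \<bullet> b else 0)"
      unfolding p_def inner_sum_left
      using orth unit that
      by (intro sum.cong) (auto simp: pairwise_def orthogonal_def dot_square_norm)
    then show ?thesis
      using fin that by simp
  qed
  have pa: "p \<bullet> a = (\<Sum>b\<in>B. (a \<bullet> b)\<^sup>2)"
    unfolding p_def inner_sum_left by (simp add: power2_eq_square inner_commute)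
  have "p \<bullet> p = (\<Sum>b\<in>B. (a \<bullet> b) * (p \<bullet> b))"
    by (subst (2) p_def) (simp add: inner_sum_right)
  also have "\<dots> = (\<Sum>b\<in>B. (a \<bullet> b)\<^sup>2)"
    by (intro sum.cong) (auto simp: pb power2_eq_square)
  finally have "(norm (a - p))\<^sup>2 = (norm a)\<^sup>2 - (\<Sum>b\<in>B. (a \<bullet> b)\<^sup>2)"
    using pa by (simp add: power2_norm_eq_inner inner_diff inner_commute)
  then show ?thesis
    using zero_le_power2[of "norm (a - p)"] by linarith
qed

text \<open>
  The basis is orthonormal for the real inner product on \<open>\<complex>\<^sup>n = \<real>\<^sup>2\<^sup>n\<close>. The real and the imaginary part of a
  complex linear form are inner products with two real vectors of the same length, which accounts for the factor 2;
  it is balanced by the doubling of dimensions in \<open>dim_supported_on\<close>.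
\<close>
lemma complex_bessel_inequality:
  fixes a :: "'n::finite \<Rightarrow> complex" and B :: "(complex^'n) set"
  assumes fin: "finite B" and orth: "pairwise orthogonal B" and unit: "\<And>b. b \<in> B \<Longrightarrow> norm b = 1"
  shows "(\<Sum>b\<in>B. (cmod (\<Sum>i\<in>I. a i * b $ i))\<^sup>2) \<le> 2 * (\<Sum>i\<in>I. (cmod (a i))\<^sup>2)"
proof -
  define r :: "complex^'n" where "r = (\<chi> i. if i \<in> I then cnj (a i) else 0)"
  define s :: "complex^'n" where "s = (\<chi> i. if i \<in> I then \<i> * cnj (a i) else 0)"
  have r: "r \<bullet> b = Re (\<Sum>i\<in>I. a i * b $ i)" for b
  proof -
    have "r \<bullet> b = (\<Sum>i\<in>UNIV. if i \<in> I then Re (a i * b $ i) else 0)"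
      unfolding inner_vec_def r_def by (intro sum.cong) (auto simp: inner_complex_def)
    then show ?thesis by (simp add: sum.If_cases)
  qed
  have s: "s \<bullet> b = Im (\<Sum>i\<in>I. a i * b $ i)" for b
  proof -
    have "s \<bullet> b = (\<Sum>i\<in>UNIV. if i \<in> I then Im (a i * b $ i) else 0)"
      unfolding inner_vec_def s_def by (intro sum.cong) (auto simp: inner_complex_def)
    then show ?thesis by (simp add: sum.If_cases)
  qed
  have nr: "(norm r)\<^sup>2 = (\<Sum>i\<in>I. (cmod (a i))\<^sup>2)"
  proof -
    have "(norm r)\<^sup>2 = (\<Sum>i\<in>UNIV. if i \<in> I then (cmod (a i))\<^sup>2 else 0)"
      unfolding norm_vec_def L2_set_def r_def
      by (simp add: sum_nonneg if_distrib[of cmod] if_distrib[of "\<lambda>z. z\<^sup>2"] cong: if_cong)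
    then show ?thesis by (simp add: sum.If_cases)
  qed
  have ns: "(norm s)\<^sup>2 = (\<Sum>i\<in>I. (cmod (a i))\<^sup>2)"
  proof -
    have "(norm s)\<^sup>2 = (\<Sum>i\<in>UNIV. if i \<in> I then (cmod (a i))\<^sup>2 else 0)"
      unfolding norm_vec_def L2_set_def s_def
      by (simp add: sum_nonneg norm_mult if_distrib[of cmod] if_distrib[of "\<lambda>z. z\<^sup>2"] cong: if_cong)
    then show ?thesis by (simp add: sum.If_cases)
  qed
  have "(\<Sum>b\<in>B. (cmod (\<Sum>i\<in>I. a i * b $ i))\<^sup>2) = (\<Sum>b\<in>B. (r \<bullet> b)\<^sup>2) + (\<Sum>b\<in>B. (s \<bullet> b)\<^sup>2)"
    by (simp add: cmod_power2 r s sum.distrib)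
  then show ?thesis
    using bessel_inequality[OF fin orth unit, of r] bessel_inequality[OF fin orth unit, of s] nr ns
    by simp
qed

definition supported_on :: "'n set \<Rightarrow> (complex^'n) set"
  where "supported_on I = {x. \<forall>i. i \<notin> I \<longrightarrow> x $ i = 0}"

lemma subspace_supported_on: "subspace (supported_on I)"
  by (auto simp: subspace_def supported_on_def)

lemma dim_supported_on: "dim (supported_on I :: (complex^'n) set) = 2 * card I"
proof -
  define d where "d = (\<lambda>(i, b). axis i b :: complex^'n) ` (I \<times> Basis)"
  have axis: "x \<bullet> axis i b = x $ i \<bullet> b" for x :: "complex^'n" and i b
    by (simp add: inner_axis)
  have "supported_on I = {x :: complex^'n. \<forall>e\<in>Basis. e \<notin> d \<longrightarrow> x \<bullet> e = 0}"
  proof (intro equalityI subsetI)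
    fix x :: "complex^'n" assume x: "x \<in> supported_on I"
    have "x \<bullet> e = 0" if e: "e \<in> Basis" "e \<notin> d" for e
    proof -
      obtain i b where ib: "e = axis i b" "b \<in> Basis"
        using e(1) by (auto simp: Basis_vec_def)
      then have "i \<notin> I"
        using e(2) by (auto simp: d_def)
      then show ?thesis
        using x ib by (simp add: axis supported_on_def)
    qed
    then show "x \<in> {x. \<forall>e\<in>Basis. e \<notin> d \<longrightarrow> x \<bullet> e = 0}" by blast
  next
    fix x :: "complex^'n" assume x: "x \<in> {x. \<forall>e\<in>Basis. e \<notin> d \<longrightarrow> x \<bullet> e = 0}"
    have "x $ i = 0" if i: "i \<notin> I" for i
    proof -
      have "x $ i \<bullet> b = 0" if b: "b \<in> Basis" for b
      proof -
        have "axis i b \<notin> d"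
          using i b by (auto simp: d_def axis_eq_axis nonzero_Basis)
        moreover have "axis i b \<in> (Basis :: (complex^'n) set)"
          using b by (auto simp: Basis_vec_def)
        ultimately show ?thesis
          using x axis[of x i b] by auto
      qed
      then show ?thesis
        using euclidean_all_zero_iff[of "x $ i"] by blast
    qed
    then show "x \<in> supported_on I"
      by (simp add: supported_on_def)
  qed
  moreover have "d \<subseteq> Basis"
    by (auto simp: d_def Basis_vec_def)
  moreover have "card d = 2 * card I"
  proof -
    have "inj_on (\<lambda>(i, b). axis i b :: complex^'n) (I \<times> Basis)"
      by (auto simp: inj_on_def axis_eq_axis nonzero_Basis)
    then have "card d = card (I \<times> (Basis :: complex set))"
      unfolding d_def by (rule card_image)
    then show ?thesis
      by (simp add: card_cartesian_product)
  qed
  ultimately show ?thesis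
    using dim_substandard[of d] by simp
qed

text \<open>
  For \<open>x\<close> supported on \<open>I\<close> with \<open>x = W y\<close> and \<open>y\<close> supported on \<open>J\<close>, one has \<open>y = V x\<close>, so \<open>x \<bullet> x\<close> is the
  inner product of \<open>x\<close> with \<open>W[I,J] V[J,I] x\<close>; moving the first block to the other side of the inner product and
  using \<open>2 (p \<bullet> q) \<le> \<bar>p\<bar>\<^sup>2 + \<bar>q\<bar>\<^sup>2\<close> separates the two. Such \<open>x\<close> form a real subspace of dimension at least
  \<open>2 (\<bar>I\<bar> + \<bar>J\<bar> - n)\<close>; summing over an orthonormal basis of it and applying Bessel's inequality to each
  linear form gives the bound.
\<close>
theorem rectangle_sum_inverse_pair:
  fixes W V :: "complex^'n^'n"
  assumes WV: "W ** V = mat 1" and VW: "V ** W = mat 1"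
  shows "2 * (real (card I) + real (card J) - real CARD('n))
    \<le> (\<Sum>i\<in>I. \<Sum>j\<in>J. (cmod (W $ i $ j))\<^sup>2 + (cmod (V $ j $ i))\<^sup>2)"
proof -
  define S where "S = supported_on I"
  define T where "T = (*v) W ` supported_on J"
  have lin: "linear ((*v) W)"
    by (rule linearI) (simp_all add: matrix_vector_right_distrib, simp add: vec_eq_iff matrix_vector_mult_def scaleR_sum_right)
  have inj: "inj ((*v) W)"
    by (rule inj_on_inverseI[where g = "(*v) V"]) (simp add: matrix_vector_mul_assoc VW)
  have S: "subspace S"
    by (simp add: S_def subspace_supported_on)
  have T: "subspace T"
    unfolding T_def by (intro linear_subspace_image lin subspace_supported_on)
  have dT: "dim T = 2 * card J"
    unfolding T_def dim_supported_on[symmetric]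
    by (rule dim_image_eq[OF lin]) (rule inj_on_subset[OF inj subset_UNIV])
  have "dim {x + y | x y. x \<in> S \<and> y \<in> T} \<le> 2 * CARD('n)"
    using dim_subset_UNIV[of "{x + y | x y. x \<in> S \<and> y \<in> T}"] by simp
  moreover have "dim {x + y | x y. x \<in> S \<and> y \<in> T} + dim (S \<inter> T) = 2 * card I + 2 * card J"
    using dim_sums_Int[OF S T] dT by (simp add: S_def dim_supported_on)
  ultimately have dim: "2 * card I + 2 * card J \<le> 2 * CARD('n) + dim (S \<inter> T)"
    by linarith
  obtain B where B: "B \<subseteq> S \<inter> T" "pairwise orthogonal B" "\<And>x. x \<in> B \<Longrightarrow> norm x = 1"
    "independent B" "card B = dim (S \<inter> T)"
    using orthonormal_basis_subspace[OF subspace_inter[OF S T]] by metis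
  have finB: "finite B"
    using B(4) by (rule independent_imp_finite)
  have *: "2 \<le> (\<Sum>j\<in>J. (cmod (\<Sum>i\<in>I. cnj (W $ i $ j) * x $ i))\<^sup>2 + (cmod (\<Sum>i\<in>I. V $ j $ i * x $ i))\<^sup>2)"
    if x: "x \<in> B" for x
  proof -
    have x0: "x $ i = 0" if "i \<notin> I" for i
      using x B(1) that by (auto simp: S_def supported_on_def)
    obtain y where y: "x = W *v y" "y \<in> supported_on J"
      using x B(1) by (auto simp: T_def)
    then have yV: "y = V *v x"
      by (simp add: matrix_vector_mul_assoc VW)
    have xi: "x $ i = (\<Sum>j\<in>J. W $ i $ j * y $ j)" for i
    proof -
      have "x $ i = (\<Sum>j\<in>UNIV. W $ i $ j * y $ j)"
        using y(1) by (simp add: matrix_vector_mult_def)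
      also have "\<dots> = (\<Sum>j\<in>J. W $ i $ j * y $ j)"
        using y(2) by (intro sum.mono_neutral_right) (auto simp: supported_on_def)
      finally show ?thesis .
    qed
    have yj: "y $ j = (\<Sum>i\<in>I. V $ j $ i * x $ i)" for j
    proof -
      have "y $ j = (\<Sum>i\<in>UNIV. V $ j $ i * x $ i)"
        using yV by (simp add: matrix_vector_mult_def)
      also have "\<dots> = (\<Sum>i\<in>I. V $ j $ i * x $ i)"
        by (intro sum.mono_neutral_right) (auto simp: x0)
      finally show ?thesis .
    qed
    have "1 = x \<bullet> x"
      using B(3)[OF x] by (simp add: dot_square_norm)
    also have "\<dots> = (\<Sum>i\<in>I. x $ i \<bullet> x $ i)"
      unfolding inner_vec_def by (intro sum.mono_neutral_right) (auto simp: x0)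
    also have "\<dots> = (\<Sum>i\<in>I. x $ i \<bullet> (\<Sum>j\<in>J. W $ i $ j * y $ j))"
      using xi by simp
    also have "\<dots> = (\<Sum>j\<in>J. \<Sum>i\<in>I. x $ i \<bullet> (W $ i $ j * y $ j))"
      by (subst sum.swap) (simp add: inner_sum_right)
    also have "\<dots> = (\<Sum>j\<in>J. (\<Sum>i\<in>I. cnj (W $ i $ j) * x $ i) \<bullet> y $ j)"
    proof (rule sum.cong[OF refl])
      have "z \<bullet> (c * w) = (cnj c * z) \<bullet> w" for z c w :: complex
        by (simp add: inner_complex_def algebra_simps)
      then show "(\<Sum>i\<in>I. x $ i \<bullet> (W $ i $ j * y $ j)) = (\<Sum>i\<in>I. cnj (W $ i $ j) * x $ i) \<bullet> y $ j" for j
        by (simp add: inner_sum_left)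
    qed
    finally have "2 = (\<Sum>j\<in>J. 2 * ((\<Sum>i\<in>I. cnj (W $ i $ j) * x $ i) \<bullet> y $ j))"
      by (simp add: sum_distrib_left[symmetric])
    also have "\<dots> \<le> (\<Sum>j\<in>J. (cmod (\<Sum>i\<in>I. cnj (W $ i $ j) * x $ i))\<^sup>2 + (cmod (y $ j))\<^sup>2)"
    proof (rule sum_mono)
      show "2 * (p \<bullet> q) \<le> (cmod p)\<^sup>2 + (cmod q)\<^sup>2" for p q
        using zero_le_power2[of "norm (p - q)"]
        by (simp add: power2_norm_eq_inner inner_diff inner_commute)
    qed
    finally show ?thesis
      unfolding yj .
  qed
  have "2 * (2 * (real (card I) + real (card J) - real CARD('n))) \<le> (\<Sum>x\<in>B. 2)"
    using dim B(5) by simp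
  also have "\<dots> \<le> (\<Sum>x\<in>B. \<Sum>j\<in>J. (cmod (\<Sum>i\<in>I. cnj (W $ i $ j) * x $ i))\<^sup>2 + (cmod (\<Sum>i\<in>I. V $ j $ i * x $ i))\<^sup>2)"
    by (intro sum_mono *)
  also have "\<dots> = (\<Sum>j\<in>J. (\<Sum>x\<in>B. (cmod (\<Sum>i\<in>I. cnj (W $ i $ j) * x $ i))\<^sup>2)
      + (\<Sum>x\<in>B. (cmod (\<Sum>i\<in>I. V $ j $ i * x $ i))\<^sup>2))"
    by (subst sum.swap) (simp add: sum.distrib)
  also have "\<dots> \<le> (\<Sum>j\<in>J. 2 * (\<Sum>i\<in>I. (cmod (cnj (W $ i $ j)))\<^sup>2) + 2 * (\<Sum>i\<in>I. (cmod (V $ j $ i))\<^sup>2))"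
    by (intro sum_mono add_mono complex_bessel_inequality finB B(2,3))
  also have "\<dots> = 2 * (\<Sum>i\<in>I. \<Sum>j\<in>J. (cmod (W $ i $ j))\<^sup>2 + (cmod (V $ j $ i))\<^sup>2)"
    by (subst sum.swap[of _ J I]) (simp add: sum.distrib sum_distrib_left)
  finally show ?thesis
    by simp
qed

section \<open>Frobenius norms of Hadamard products\<close>

lemma frobenius_norm_hadamard_sq:
  "(frobenius_norm (W \<circ>\<^sub>H G))\<^sup>2 = (\<Sum>i\<in>UNIV. \<Sum>j\<in>UNIV. (cmod (W $ i $ j))\<^sup>2 * (cmod (G $ i $ j))\<^sup>2)"
  by (simp add: frobenius_norm_def hadamard_def sum_nonneg norm_mult power_mult_distrib)

lemma frobenius_norm_hadamard_scaleR:
  "frobenius_norm ((c *\<^sub>R W) \<circ>\<^sub>H G) = \<bar>c\<bar> * frobenius_norm (W \<circ>\<^sub>H G)"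
proof -
  have "(c *\<^sub>R W) \<circ>\<^sub>H G = c *\<^sub>R (W \<circ>\<^sub>H G)"
    by (simp add: hadamard_def vec_eq_iff)
  then show ?thesis
    by (simp add: frobenius_norm_eq_norm)
qed

lemma frobenius_norm_permutation_sq:
  fixes G :: "complex^'n^'n"
  shows "(frobenius_norm ((\<chi> i j. if j = \<sigma> i then 1 else 0) \<circ>\<^sub>H G))\<^sup>2
    = (\<Sum>i\<in>UNIV. (cmod (G $ i $ \<sigma> i))\<^sup>2)"
proof -
  have "(cmod (if P then 1 else 0))\<^sup>2 * z = (if P then z else 0)" for P z
    by simp
  then show ?thesis
    unfolding frobenius_norm_hadamard_sq by (simp del: power_mult_distrib)
qed

lemma permutation_assignment_le_norm_sq_sum:
  fixes G W V :: "complex^'n^'n"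
  assumes WV: "W ** V = mat 1" and VW: "V ** W = mat 1"
  obtains P :: "complex^'n^'n" where "permutation_matrix P"
    "2 * (frobenius_norm (P \<circ>\<^sub>H G))\<^sup>2
      \<le> (frobenius_norm (W \<circ>\<^sub>H G))\<^sup>2 + (frobenius_norm (V \<circ>\<^sub>H transpose G))\<^sup>2"
proof -
  define h where "h i j = ((cmod (W $ i $ j))\<^sup>2 + (cmod (V $ j $ i))\<^sup>2) / 2" for i j
  define c where "c i j = (cmod (G $ i $ j))\<^sup>2" for i j
  have "real (card I) + real (card J) - real CARD('n) \<le> (\<Sum>i\<in>I. \<Sum>j\<in>J. h i j)" for I J
    using rectangle_sum_inverse_pair[OF WV VW, of I J]
    by (simp add: h_def sum_divide_distrib[symmetric])
  then obtain \<sigma> where sigma: "\<sigma> permutes UNIV"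
    and le: "(\<Sum>i\<in>UNIV. c i (\<sigma> i)) \<le> (\<Sum>i\<in>UNIV. \<Sum>j\<in>UNIV. h i j * c i j)"
    using assignment_le_of_rectangle_sums[of h c] by (auto simp: h_def c_def)
  have "(frobenius_norm (V \<circ>\<^sub>H transpose G))\<^sup>2
      = (\<Sum>i\<in>UNIV. \<Sum>j\<in>UNIV. (cmod (V $ j $ i))\<^sup>2 * c i j)"
    unfolding frobenius_norm_hadamard_sq
    by (subst sum.swap) (simp add: c_def transpose_def)
  then have "(frobenius_norm (W \<circ>\<^sub>H G))\<^sup>2 + (frobenius_norm (V \<circ>\<^sub>H transpose G))\<^sup>2
      = 2 * (\<Sum>i\<in>UNIV. \<Sum>j\<in>UNIV. h i j * c i j)"
    by (simp add: frobenius_norm_hadamard_sq[of W] c_def h_def sum_distrib_left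
        sum.distrib[symmetric] add_divide_distrib distrib_right)
  moreover have "(frobenius_norm ((\<chi> i j. if j = \<sigma> i then 1 else 0) \<circ>\<^sub>H G))\<^sup>2 = (\<Sum>i\<in>UNIV. c i (\<sigma> i))"
    by (simp add: frobenius_norm_permutation_sq c_def)
  ultimately show thesis
    using that[of "\<chi> i j. if j = \<sigma> i then 1 else 0"] le sigma
    by (auto simp: permutation_matrix_def)
qed

section \<open>Permutation matrices and the minimum over nonsingular matrices\<close>

text \<open>
  The scaling \<open>t = sqrt (b / a)\<close> makes both squares equal to \<open>a b\<close>. As \<open>a\<close> or \<open>b\<close> may vanish, both are
  first increased by \<open>e > 0\<close>, and \<open>e\<close> then tends to 0.
\<close>
lemma le_mult_of_scaled_squares:
  fixes a b m :: real
  assumes a: "0 \<le> a" and b: "0 \<le> b" and le: "\<And>t. 0 < t \<Longrightarrow> 2 * m \<le> (t * a)\<^sup>2 + (b / t)\<^sup>2"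
  shows "m \<le> a * b"
proof (rule tendsto_lowerbound)
  show "((\<lambda>e. (a + e) * (b + e)) \<longlongrightarrow> a * b) (at_right 0)"
    by (auto intro!: tendsto_eq_intros)
  show "\<forall>\<^sub>F e in at_right 0. m \<le> (a + e) * (b + e)"
    using eventually_at_right_less
  proof eventually_elim
    fix e :: real assume e: "0 < e"
    define t where "t = sqrt ((b + e) / (a + e))"
    have t: "0 < t" and t2: "t\<^sup>2 = (b + e) / (a + e)"
      using a b e by (auto simp: t_def)
    have "(t * a)\<^sup>2 \<le> t\<^sup>2 * (a + e)\<^sup>2"
      using a e by (simp add: power_mult_distrib mult_left_mono power_mono)
    also have "\<dots> = (a + e) * (b + e)"
      using a e by (simp add: t2 power2_eq_square[of "a + e"])
    finally have 1: "(t * a)\<^sup>2 \<le> (a + e) * (b + e)" .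
    have "(b / t)\<^sup>2 \<le> (b + e)\<^sup>2 / t\<^sup>2"
      using b e by (simp add: power_divide divide_right_mono power_mono)
    also have "\<dots> = (a + e) * (b + e)"
      using a b e by (simp add: t2 power2_eq_square[of "b + e"])
    finally have 2: "(b / t)\<^sup>2 \<le> (a + e) * (b + e)" .
    show "m \<le> (a + e) * (b + e)"
      using le[OF t] 1 2 by linarith
  qed
qed simp

lemma invertible_matrix_inv_mult:
  fixes W :: "'a::semiring_1^'n^'n"
  assumes "invertible W"
  shows "W ** matrix_inv W = mat 1" "matrix_inv W ** W = mat 1"
  using someI_ex[OF assms[unfolded invertible_def]] by (simp_all add: matrix_inv_def)

lemma permutation_matrix_inverse:
  fixes P :: "complex^'n^'n"
  assumes "permutation_matrix P"
  shows "invertible P" "matrix_inv P = transpose P"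
proof -
  obtain \<sigma> where sigma: "\<sigma> permutes UNIV" and P: "P = (\<chi> i j. if j = \<sigma> i then 1 else 0)"
    using assms by (auto simp: permutation_matrix_def)
  have "(\<Sum>k\<in>UNIV. (if k = \<sigma> i then 1 else 0) * (if k = \<sigma> j then 1 else 0 :: complex)) = (if i = j then 1 else 0)"
    for i j
  proof -
    have "(\<Sum>k\<in>UNIV. (if k = \<sigma> i then 1 else 0) * (if k = \<sigma> j then 1 else 0 :: complex))
        = (\<Sum>k\<in>UNIV. if k = \<sigma> i then (if k = \<sigma> j then 1 else 0) else 0)"
      by (intro sum.cong) auto
    then show ?thesis
      using inj_eq[OF permutes_inj[OF sigma]] by simp
  qed
  then have 1: "P ** transpose P = mat 1"
    by (simp add: P matrix_matrix_mult_def transpose_def mat_def vec_eq_iff)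
  then have 2: "transpose P ** P = mat 1"
    by (rule matrix_left_right_inverse[THEN iffD1])
  show inv: "invertible P"
    unfolding invertible_def using 1 2 by blast
  have "matrix_inv P = matrix_inv P ** (P ** transpose P)"
    by (simp add: 1)
  then show "matrix_inv P = transpose P"
    by (simp add: matrix_mul_assoc invertible_matrix_inv_mult(2)[OF inv])
qed

lemma frobenius_norm_hadamard_transpose:
  "frobenius_norm (transpose W \<circ>\<^sub>H transpose G) = frobenius_norm (W \<circ>\<^sub>H G)"
  unfolding frobenius_norm_def hadamard_def transpose_def
  by (subst sum.swap) simp

theorem theorem1p1:
  fixes G :: "complex^'n^'n"
  shows "is_minimum
    {frobenius_norm (W \<circ>\<^sub>H G) * frobenius_norm (matrix_inv W \<circ>\<^sub>H transpose G)
      | W :: complex^'n^'n. invertible W}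
    (Min {(frobenius_norm (P \<circ>\<^sub>H G))\<^sup>2 | P :: complex^'n^'n. permutation_matrix P})"
proof -
  define A where "A = {(frobenius_norm (P \<circ>\<^sub>H G))\<^sup>2 | P :: complex^'n^'n. permutation_matrix P}"
  define m where "m = Min A"
  have fin: "finite A"
    unfolding A_def using finite_permutation_matrices by (rule finite_image_set)
  have "A \<noteq> {}"
    unfolding A_def using permutation_matrix_mat_1 by blast
  then have "m \<in> A"
    unfolding m_def by (intro Min_in fin)
  then obtain P :: "complex^'n^'n" where P: "permutation_matrix P" "m = (frobenius_norm (P \<circ>\<^sub>H G))\<^sup>2"
    by (auto simp: A_def)
  have "m = frobenius_norm (P \<circ>\<^sub>H G) * frobenius_norm (matrix_inv P \<circ>\<^sub>H transpose G)"
    using P permutation_matrix_inverse(2)[OF P(1)]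
    by (simp add: frobenius_norm_hadamard_transpose power2_eq_square)
  then have attained: "m \<in> {frobenius_norm (W \<circ>\<^sub>H G) * frobenius_norm (matrix_inv W \<circ>\<^sub>H transpose G)
      | W :: complex^'n^'n. invertible W}"
    using permutation_matrix_inverse(1)[OF P(1)] by blast
  have lower: "m \<le> frobenius_norm (W \<circ>\<^sub>H G) * frobenius_norm (matrix_inv W \<circ>\<^sub>H transpose G)"
    if W: "invertible W" for W :: "complex^'n^'n"
  proof (rule le_mult_of_scaled_squares)
    fix t :: real assume t: "0 < t"
    have WV: "(t *\<^sub>R W) ** ((1 / t) *\<^sub>R matrix_inv W) = mat 1"
      using invertible_matrix_inv_mult(1)[OF W] t by (simp add: scalar_matrix_assoc[symmetric] matrix_scalar_ac)
    have VW: "((1 / t) *\<^sub>R matrix_inv W) ** (t *\<^sub>R W) = mat 1"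
      using invertible_matrix_inv_mult(2)[OF W] t by (simp add: scalar_matrix_assoc[symmetric] matrix_scalar_ac)
    obtain Q :: "complex^'n^'n" where Q: "permutation_matrix Q"
      "2 * (frobenius_norm (Q \<circ>\<^sub>H G))\<^sup>2 \<le> (frobenius_norm ((t *\<^sub>R W) \<circ>\<^sub>H G))\<^sup>2
        + (frobenius_norm (((1 / t) *\<^sub>R matrix_inv W) \<circ>\<^sub>H transpose G))\<^sup>2"
      using permutation_assignment_le_norm_sq_sum[OF WV VW] by blast
    have "m \<le> (frobenius_norm (Q \<circ>\<^sub>H G))\<^sup>2"
      unfolding m_def by (rule Min_le[OF fin]) (use Q(1) in \<open>auto simp: A_def\<close>)
    then show "2 * m \<le> (t * frobenius_norm (W \<circ>\<^sub>H G))\<^sup>2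
        + (frobenius_norm (matrix_inv W \<circ>\<^sub>H transpose G) / t)\<^sup>2"
      using Q(2) t by (simp add: frobenius_norm_hadamard_scaleR)
  qed (simp_all add: frobenius_norm_eq_norm)
  show ?thesis
    using attained lower by (auto simp: is_minimum_def m_def A_def)
qed

end
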